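(* Let $H=\Delta-\partial_t$ be the heat operator in $\mathbb{R}^{N+1}$ and let $\partial P=\{(x,t)\in\mathbb{R}^{N+1} : t=|x|^2\}$. Let $p$ be a polynomial in $\mathbb{R}^{N+1}$. Then there exists a unique polynomial $u_p$ in $\mathbb{R}^{N+1}$ such that $$\begin{cases} H u_p=0 & \text{in } \mathbb{R}^{N+1},\\ u_p=p & \text{on } \partial P.\end{cases}$$
   Context: $N\ge 1$ is an integer; points of $\mathbb{R}^{N+1}$ are written $z=(x,t)$ with $x\in\mathbb{R}^N$, $t\in\mathbb{R}$, and $|x|$ is the Euclidean norm of $x$. $\Delta=\sum_{j=1}^N\partial_{x_j}^2$ is the Laplacian in the spatial variables $x$. A polynomial in $\mathbb{R}^{N+1}$ is a polynomial function of $z=(x,t)$ with real coefficients. The set $\partial P$ is the boundary of the open region $P=\{(x,t)\in\mathbb{R}^{N+1} : t>|x|^2\}$. *)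

theory Defs
  imports "HOL-Analysis.Analysis"
begin

text \<open>
  Points of \<open>\<real>\<^sup>N\<^sup>+\<^sup>1\<close> are pairs \<open>(x, t)\<close> of type \<open>(real ^ 'n) \<times> real\<close> with \<open>N = CARD('n) \<ge> 1\<close>.
  Polynomials on this space are the functions satisfying \<^const>\<open>real_polynomial_function\<close>.
\<close>

definition partial_deriv :: "'a::real_vector \<Rightarrow> ('a \<Rightarrow> real) \<Rightarrow> 'a \<Rightarrow> real" where
  "partial_deriv v f z = deriv (\<lambda>s. f (z + s *\<^sub>R v)) 0"

definition spatial_laplacian ::
  "((real ^ 'n) \<times> real \<Rightarrow> real) \<Rightarrow> (real ^ 'n) \<times> real \<Rightarrow> real" where
  "spatial_laplacian u z =
     (\<Sum>j\<in>UNIV. partial_deriv (axis j 1, 0) (partial_deriv (axis j 1, 0) u) z)"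

definition heat_operator ::
  "((real ^ 'n) \<times> real \<Rightarrow> real) \<Rightarrow> (real ^ 'n) \<times> real \<Rightarrow> real" where
  "heat_operator u z = spatial_laplacian u z - partial_deriv (0, 1) u z"

definition paraboloid_region :: "((real ^ 'n) \<times> real) set" where
  "paraboloid_region = {(x, t). t > (norm x)\<^sup>2}"

definition paraboloid_boundary :: "((real ^ 'n) \<times> real) set" where
  "paraboloid_boundary = {(x, t). t = (norm x)\<^sup>2}"

lemma frontier_paraboloid_region:
  "frontier (paraboloid_region :: ((real ^ 'n) \<times> real) set) = paraboloid_boundary"
proof -
  let ?P = "paraboloid_region :: ((real ^ 'n) \<times> real) set"
  let ?C = "{z. (norm (fst z))\<^sup>2 \<le> snd z} :: ((real ^ 'n) \<times> real) set"
  have P: "?P = {z. (norm (fst z))\<^sup>2 < snd z}"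
    by (auto simp: paraboloid_region_def)
  have "open ?P"
    unfolding P by (intro open_Collect_less continuous_intros)
  have "closed ?C"
    by (intro closed_Collect_le continuous_intros)
  have "?P \<subseteq> ?C"
    unfolding P by auto
  have "?C \<subseteq> closure ?P"
  proof
    fix z :: "(real ^ 'n) \<times> real"
    assume "z \<in> ?C"
    define y where "y n = (fst z, snd z + inverse (real (Suc n)))" for n
    have "y n \<in> ?P" for n
    proof -
      have "inverse (real (Suc n)) > 0" by simp
      then show ?thesis
        using \<open>z \<in> ?C\<close> unfolding P y_def mem_Collect_eq fst_conv snd_conv by linarith
    qed
    moreover have "y \<longlonglongrightarrow> (fst z, snd z + 0)"
      unfolding y_def by (intro tendsto_intros LIMSEQ_inverse_real_of_nat)
    ultimately show "z \<in> closure ?P"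
      unfolding closure_sequential by auto
  qed
  with \<open>?P \<subseteq> ?C\<close> \<open>closed ?C\<close> have "closure ?P = ?C"
    by (simp add: closure_minimal subset_antisym)
  then have "frontier ?P = ?C - ?P"
    by (simp add: frontier_def interior_open[OF \<open>open ?P\<close>])
  also have "\<dots> = paraboloid_boundary"
    unfolding P paraboloid_boundary_def by auto
  finally show ?thesis .
qed

end

theory Submission
  imports Defs "HOL-Library.Function_Algebras"
begin

text \<open>
  For a polynomial \<open>q\<close> put \<open>T q = H ((t - \<bar>x\<bar>\<^sup>2) q)\<close>. In the grading where every \<open>x\<^sub>j\<close> has degree 1
  and \<open>t\<close> has degree 2, multiplication by \<open>t - \<bar>x\<bar>\<^sup>2\<close> raises the degree by 2 and \<open>H\<close> lowers it by 2,
  so \<open>T\<close> maps the finite-dimensional space of polynomials of degree at most \<open>m\<close> into itself.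
  By the maximum principle on the bounded sets \<open>\<bar>x\<bar>\<^sup>2 \<le> t \<le> t\<^sub>0\<close>, whose parabolic boundary lies on
  the paraboloid, a caloric polynomial vanishing on the paraboloid is zero. This gives uniqueness
  and the injectivity, hence the surjectivity, of \<open>T\<close>. If \<open>T q = H p\<close>, then
  \<open>u = p - (t - \<bar>x\<bar>\<^sup>2) q\<close> is the solution.
\<close>

section \<open>Linear maps of finite-dimensional subspaces\<close>

text \<open>\<open>V\<close> is spanned by a finite independent set \<open>C\<close>. An injective
  linear map sends \<open>C\<close> to an independent set of the same size inside \<open>V\<close>,
  which must therefore span \<open>V\<close> again.\<close>

lemma (in vector_space) injective_imp_surjective_on_finite_span:
  assumes V: "subspace V" and B: "finite B" "V \<subseteq> span B"
    and T: "\<And>x. x \<in> V \<Longrightarrow> T x \<in> V"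
    and add: "\<And>x y. x \<in> V \<Longrightarrow> y \<in> V \<Longrightarrow> T (x + y) = T x + T y"
    and scale: "\<And>c x. x \<in> V \<Longrightarrow> T (scale c x) = scale c (T x)"
    and inj: "\<And>x. x \<in> V \<Longrightarrow> T x = 0 \<Longrightarrow> x = 0"
    and y: "y \<in> V"
  shows "\<exists>x\<in>V. T x = y"
proof -
  interpret vp: vector_space_pair scale scale ..
  obtain C where C: "C \<subseteq> V" "independent C" "V \<subseteq> span C"
    using maximal_independent_subset by blast
  have finC: "finite C"
    using independent_span_bound[OF B(1) C(2)] C(1) B(2) by blast
  have spanC: "span C = V"
    using span_minimal[OF C(1) V] C(3) by blast
  \<comment> \<open>\<open>T\<close> is assumed linear on \<open>V\<close> only. The theory of
    linear maps applies to \<open>g\<close>, which is linear everywhere and agrees with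
    \<open>T\<close> on \<open>span C = V\<close>.\<close>
  obtain g where g: "Vector_Spaces.linear scale scale g" and gC: "\<forall>x\<in>C. g x = T x"
    using vp.linear_independent_extend[OF C(2)] by blast
  interpret g: Vector_Spaces.linear scale scale g by (rule g)
  have T0: "T 0 = 0"
    using scale[OF subspace_0[OF V], of 0] by simp
  have "span C \<subseteq> {x \<in> V. g x = T x}"
  proof (rule span_minimal)
    show "C \<subseteq> {x \<in> V. g x = T x}" using C(1) gC by blast
    show "subspace {x \<in> V. g x = T x}"
      unfolding subspace_def
      using V T0 by (auto simp: subspace_0 subspace_add subspace_scale g.add g.scale add scale)
  qed
  then have gT: "g x = T x" if "x \<in> V" for x
    using that spanC by blast
  have inj_g: "inj_on g (span C)"
    using vp.linear_inj_on_iff_eq_0[OF g subspace_span, of C] gT inj spanC by auto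
  have ind: "independent (g ` C)"
    using vp.linear_independent_injective_image[OF g C(2) inj_g] .
  have sub: "g ` C \<subseteq> V" using C(1) gT T by auto
  have card: "card (g ` C) = card C"
    using inj_g by (meson card_image inj_on_subset span_superset)
  have "y \<in> span (g ` C)"
  proof (rule ccontr)
    \<comment> \<open>Adjoining \<open>y\<close> would give \<open>card C + 1\<close> independent
      vectors in the span of \<open>C\<close>.\<close>
    assume ny: "y \<notin> span (g ` C)"
    have "independent (insert y (g ` C))" using independent_insertI[OF ny ind] .
    moreover have "insert y (g ` C) \<subseteq> span C" using sub y spanC by auto
    ultimately have "card (insert y (g ` C)) \<le> card C"
      using independent_span_bound[OF finC] by blast
    moreover have "y \<notin> g ` C" using ny span_base by blast
    ultimately show False using card finC by simp
  qed
  then obtain x where "x \<in> V" "y = g x"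
    using vp.linear_span_image[OF g] spanC by auto
  with gT show ?thesis by auto
qed

section \<open>Partial derivatives of polynomials\<close>

lemmas real_polynomial_function_linear = real_polynomial_function.intros(1)
  and real_polynomial_function_const = real_polynomial_function.intros(2)
  and real_polynomial_function_add = real_polynomial_function.intros(3)
  and real_polynomial_function_mult = real_polynomial_function.intros(4)

lemma real_polynomial_function_compose_line:
  assumes "real_polynomial_function f"
  shows "real_polynomial_function (\<lambda>s::real. f (z + s *\<^sub>R v))"
proof -
  have "polynomial_function (\<lambda>s::real. z + s *\<^sub>R v)"
    by (intro polynomial_function_add polynomial_function_const polynomial_function_bounded_linear
        bounded_linear_scaleR_left)
  from real_polynomial_function_compose[OF this assms] show ?thesis by (simp add: o_def)
qed

text \<open>\<open>deriv\<close> has an unspecified value where no derivative exists. On a line a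
  polynomial is a polynomial in one variable, so the derivative exists; a shift of the base point
  moves it from 0 to \<open>a\<close>.\<close>

lemma has_real_derivative_partial_deriv:
  assumes "real_polynomial_function f"
  shows "((\<lambda>s. f (z + s *\<^sub>R v)) has_real_derivative partial_deriv v f (z + a *\<^sub>R v)) (at a)"
proof -
  obtain D where "((\<lambda>s. f ((z + a *\<^sub>R v) + s *\<^sub>R v)) has_real_derivative D) (at 0)"
    using has_real_derivative_polynomial_function[OF real_polynomial_function_compose_line[OF assms]]
    by blast
  then have "((\<lambda>s. f ((z + a *\<^sub>R v) + s *\<^sub>R v)) has_real_derivative
      partial_deriv v f (z + a *\<^sub>R v)) (at 0)"
    unfolding partial_deriv_def by (metis DERIV_imp_deriv)
  then show ?thesis
    using DERIV_shift[of "\<lambda>s. f (z + s *\<^sub>R v)" "partial_deriv v f (z + a *\<^sub>R v)" 0 a]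
    by (simp add: algebra_simps)
qed

lemma has_real_derivative_partial_deriv_0:
  assumes "real_polynomial_function f"
  shows "((\<lambda>s. f (z + s *\<^sub>R v)) has_real_derivative partial_deriv v f z) (at 0)"
  using has_real_derivative_partial_deriv[OF assms, of z v 0] by simp

lemma partial_deriv_const [simp]: "partial_deriv v (\<lambda>_. c) = (\<lambda>_. 0)"
  by (auto simp: partial_deriv_def)

lemma partial_deriv_bounded_linear:
  assumes "bounded_linear f"
  shows "partial_deriv v f = (\<lambda>_. f v)"
proof
  fix z
  interpret bounded_linear f by (rule assms)
  have "((\<lambda>s. f (z + s *\<^sub>R v)) has_real_derivative f v) (at 0)"
    unfolding add scaleR by (auto intro!: derivative_eq_intros)
  then show "partial_deriv v f z = f v"
    unfolding partial_deriv_def by (rule DERIV_imp_deriv)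
qed

lemma partial_deriv_add:
  assumes "real_polynomial_function f" "real_polynomial_function g"
  shows "partial_deriv v (\<lambda>z. f z + g z) = (\<lambda>z. partial_deriv v f z + partial_deriv v g z)"
proof
  fix z
  show "partial_deriv v (\<lambda>z. f z + g z) z = partial_deriv v f z + partial_deriv v g z"
    unfolding partial_deriv_def[of v "\<lambda>z. f z + g z"]
    by (intro DERIV_imp_deriv DERIV_add has_real_derivative_partial_deriv_0 assms)
qed

lemma partial_deriv_mult:
  assumes "real_polynomial_function f" "real_polynomial_function g"
  shows "partial_deriv v (\<lambda>z. f z * g z) =
    (\<lambda>z. partial_deriv v f z * g z + partial_deriv v g z * f z)"
proof
  fix z
  have "((\<lambda>s. f (z + s *\<^sub>R v) * g (z + s *\<^sub>R v)) has_real_derivative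
      partial_deriv v f z * g (z + 0 *\<^sub>R v) + partial_deriv v g z * f (z + 0 *\<^sub>R v)) (at 0)"
    by (intro DERIV_mult has_real_derivative_partial_deriv_0 assms)
  then show "partial_deriv v (\<lambda>z. f z * g z) z = partial_deriv v f z * g z + partial_deriv v g z * f z"
    unfolding partial_deriv_def[of v "\<lambda>z. f z * g z"] by (simp add: DERIV_imp_deriv)
qed

lemma partial_deriv_cmult:
  assumes "real_polynomial_function f"
  shows "partial_deriv v (\<lambda>z. c * f z) = (\<lambda>z. c * partial_deriv v f z)"
  using partial_deriv_mult[OF real_polynomial_function_const assms] by (simp add: mult.commute)

lemma real_polynomial_function_partial_deriv:
  assumes "real_polynomial_function f"
  shows "real_polynomial_function (partial_deriv v f)"
  using assms
proof induction
  case (linear f)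
  then show ?case by (simp add: partial_deriv_bounded_linear real_polynomial_function_const)
next
  case (const c)
  then show ?case by (simp add: real_polynomial_function_const)
next
  case (add f g)
  then show ?case by (auto simp: partial_deriv_add)
next
  case (mult f g)
  then show ?case by (auto simp: partial_deriv_mult)
qed

lemma heat_operator_add:
  assumes "real_polynomial_function f" "real_polynomial_function g"
  shows "heat_operator (\<lambda>z. f z + g z) z = heat_operator f z + heat_operator g z"
  using assms
  by (simp add: heat_operator_def spatial_laplacian_def partial_deriv_add
      real_polynomial_function_partial_deriv sum.distrib)

lemma heat_operator_cmult:
  assumes "real_polynomial_function f"
  shows "heat_operator (\<lambda>z. c * f z) z = c * heat_operator f z"
  using assms
  by (simp add: heat_operator_def spatial_laplacian_def partial_deriv_cmult
      real_polynomial_function_partial_deriv sum_distrib_left right_diff_distrib)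

lemma heat_operator_diff:
  assumes "real_polynomial_function f" "real_polynomial_function g"
  shows "heat_operator (\<lambda>z. f z - g z) z = heat_operator f z - heat_operator g z"
  using heat_operator_add[OF assms(1), of "\<lambda>z. (-1) * g z" z] heat_operator_cmult[OF assms(2), of "-1" z]
    assms by auto

lemma heat_operator_snd: "heat_operator snd z = - 1"
  by (simp add: heat_operator_def spatial_laplacian_def partial_deriv_bounded_linear bounded_linear_snd)

section \<open>The maximum principle\<close>

text \<open>At the maximum \<open>f' 0 = 0\<close>. If \<open>D > 0\<close>, then \<open>f'\<close>
  is positive just to the right of 0, so \<open>f\<close> increases strictly there and exceeds
  \<open>f 0\<close>.\<close>

lemma second_deriv_nonpos_at_local_max:
  fixes f f' :: "real \<Rightarrow> real"
  assumes f: "\<And>s. (f has_real_derivative f' s) (at s)"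
    and f': "(f' has_real_derivative D) (at 0)"
    and d: "d > 0" and le: "\<And>s. \<bar>s\<bar> < d \<Longrightarrow> f s \<le> f 0"
  shows "D \<le> 0"
proof (rule ccontr)
  assume "\<not> D \<le> 0"
  then obtain e where e: "e > 0" "\<And>h. 0 < h \<Longrightarrow> h < e \<Longrightarrow> f' 0 < f' h"
    using DERIV_pos_inc_right[OF f'] by auto
  have f'0: "f' 0 = 0"
    using DERIV_local_max[OF f d] le by simp
  define b where "b = min e d / 2"
  have b: "0 < b" "b < e" "b < d" using e d by (auto simp: b_def)
  have "f 0 < f b"
  proof (rule DERIV_pos_imp_increasing_open[OF b(1)])
    show "\<exists>y. DERIV f x :> y \<and> y > 0" if "0 < x" "x < b" for x
      using f[of x] e(2)[of x] that b f'0 by auto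
    show "continuous_on {0..b} f"
      using f by (meson DERIV_atLeastAtMost_imp_continuous_on)
  qed
  then show False using le[of b] b by auto
qed

lemma open_paraboloid_region: "open (paraboloid_region :: ((real ^ 'n) \<times> real) set)"
proof -
  have P: "paraboloid_region = {z :: (real ^ 'n) \<times> real. (norm (fst z))\<^sup>2 < snd z}"
    by (auto simp: paraboloid_region_def)
  show ?thesis unfolding P by (intro open_Collect_less continuous_intros)
qed

text \<open>If \<open>u z0 > 0\<close>, the perturbation \<open>w = u - e t\<close> has
  \<open>H w = e > 0\<close> and is still positive at \<open>z0\<close>. Its maximum over the
  compact set \<open>K\<close> then lies off the paraboloid, and there the derivative tests force
  \<open>H w\<close> to be nonpositive.\<close>

lemma caloric_nonpos_in_paraboloid:
  fixes u :: "(real ^ 'n) \<times> real \<Rightarrow> real"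
  assumes u: "real_polynomial_function u"
    and H: "\<And>z. heat_operator u z = 0"
    and bdry: "\<And>z. z \<in> paraboloid_boundary \<Longrightarrow> u z = 0"
    and z0: "z0 \<in> paraboloid_region"
  shows "u z0 \<le> 0"
proof (rule ccontr)
  assume "\<not> u z0 \<le> 0"
  then have u0: "u z0 > 0" by simp
  define T where "T = snd z0"
  have T: "(norm (fst z0))\<^sup>2 < T" using z0 by (auto simp: paraboloid_region_def T_def)
  then have T0: "T > 0" by (smt (verit) zero_le_power2)
  \<comment> \<open>With this slope the perturbation costs exactly half of \<open>u z0\<close> at
    height \<open>T\<close>.\<close>
  define e where "e = u z0 / (2 * T)"
  have e: "e > 0" using u0 T0 by (simp add: e_def)
  define w where "w = (\<lambda>z. u z - e * snd z)"
  have snd: "real_polynomial_function (snd :: (real ^ 'n) \<times> real \<Rightarrow> real)"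
    by (intro real_polynomial_function_linear bounded_linear_snd)
  have esnd: "real_polynomial_function (\<lambda>z :: (real ^ 'n) \<times> real. e * snd z)"
    by (intro real_polynomial_function_mult real_polynomial_function_const snd)
  have w: "real_polynomial_function w"
    unfolding w_def by (rule real_polynomial_function_diff[OF u esnd])
  have Hw: "heat_operator w z = e" for z
    unfolding w_def heat_operator_diff[OF u esnd] heat_operator_cmult[OF snd]
    by (simp add: H heat_operator_snd)
  define K where "K = {z :: (real ^ 'n) \<times> real. (norm (fst z))\<^sup>2 \<le> snd z \<and> snd z \<le> T}"
  have "compact K"
  proof -
    have "closed K"
      unfolding K_def by (intro closed_Collect_conj closed_Collect_le continuous_intros)
    moreover have "K \<subseteq> cball 0 (sqrt T) \<times> {0..T}"
    proof
      fix z assume "z \<in> K"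
      then have "(norm (fst z))\<^sup>2 \<le> snd z" "snd z \<le> T" by (auto simp: K_def)
      then have "norm (fst z) \<le> sqrt T" "0 \<le> snd z"
        by (auto intro: real_le_rsqrt order_trans[OF zero_le_power2])
      with \<open>snd z \<le> T\<close> show "z \<in> cball 0 (sqrt T) \<times> {0..T}" by (cases z) auto
    qed
    moreover have "compact (cball (0 :: real ^ 'n) (sqrt T) \<times> {0..T})"
      by (intro compact_Times compact_cball compact_Icc)
    ultimately show ?thesis
      using bounded_subset compact_imp_bounded compact_eq_bounded_closed by metis
  qed
  moreover have z0K: "z0 \<in> K" using T by (simp add: K_def T_def)
  moreover have "continuous_on K w"
    using w by (simp add: continuous_on_polymonial_function real_polynomial_function_eq)
  ultimately obtain z1 where z1: "z1 \<in> K" "\<And>z. z \<in> K \<Longrightarrow> w z \<le> w z1"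
    using continuous_attains_sup[of K w] by blast
  have "w z0 = u z0 / 2" using T0 by (simp add: w_def e_def T_def[symmetric])
  then have w1: "w z1 > 0" using z1(2)[OF z0K] u0 by simp
  have "z1 \<notin> paraboloid_boundary"
  proof
    assume b: "z1 \<in> paraboloid_boundary"
    then have "snd z1 \<ge> 0" by (auto simp: paraboloid_boundary_def)
    then have "w z1 \<le> 0" using bdry[OF b] e by (simp add: w_def)
    then show False using w1 by simp
  qed
  then have lt: "(norm (fst z1))\<^sup>2 < snd z1" and le: "snd z1 \<le> T"
    using z1(1) by (cases z1; force simp: K_def paraboloid_boundary_def)+
  have "z1 \<in> paraboloid_region" using lt by (cases z1) (simp add: paraboloid_region_def)
  then obtain d where d: "d > 0" "ball z1 d \<subseteq> paraboloid_region"
    using open_paraboloid_region open_contains_ball by blast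
  \<comment> \<open>The maximum point may lie on the cap \<open>t = T\<close>, so only displacements
    that do not increase \<open>t\<close> surely stay in \<open>K\<close>. These cover both senses
    of each spatial direction, but only the past in time.\<close>
  have near: "w (z1 + s *\<^sub>R v) \<le> w z1"
    if "norm v = 1" "\<bar>s\<bar> < d" "s * snd v \<le> 0" for s v
  proof (rule z1(2))
    have "z1 + s *\<^sub>R v \<in> paraboloid_region"
      using d(2) that by (intro subsetD[OF d(2)]) (simp add: dist_norm)
    then show "z1 + s *\<^sub>R v \<in> K"
      using le that(3) by (cases "z1 + s *\<^sub>R v") (auto simp: paraboloid_region_def K_def prod_eq_iff)
  qed
  have "partial_deriv (axis j 1, 0) (partial_deriv (axis j 1, 0) w) z1 \<le> 0" for j
  proof (rule second_deriv_nonpos_at_local_max[OF _ _ d(1)])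
    let ?v = "(axis j 1, 0) :: (real ^ 'n) \<times> real"
    show "((\<lambda>s. w (z1 + s *\<^sub>R ?v)) has_real_derivative partial_deriv ?v w (z1 + s *\<^sub>R ?v)) (at s)" for s
      by (rule has_real_derivative_partial_deriv[OF w])
    show "((\<lambda>s. partial_deriv ?v w (z1 + s *\<^sub>R ?v)) has_real_derivative
        partial_deriv ?v (partial_deriv ?v w) z1) (at 0)"
      by (intro has_real_derivative_partial_deriv_0 real_polynomial_function_partial_deriv w)
    show "w (z1 + s *\<^sub>R ?v) \<le> w (z1 + 0 *\<^sub>R ?v)" if "\<bar>s\<bar> < d" for s
      using near[of ?v s] that by (simp add: norm_Pair del: scaleR_Pair)
  qed
  then have "spatial_laplacian w z1 \<le> 0"
    unfolding spatial_laplacian_def by (intro sum_nonpos) auto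
  moreover have "partial_deriv (0, 1) w z1 \<ge> 0"
  proof (rule ccontr)
    let ?v = "(0, 1) :: (real ^ 'n) \<times> real"
    assume "\<not> ?thesis"
    \<comment> \<open>A negative time derivative would make \<open>w\<close> larger at slightly
      earlier times, which contradicts \<open>near\<close>.\<close>
    then obtain b where b: "b > 0" "\<And>h. 0 < h \<Longrightarrow> h < b \<Longrightarrow> w (z1 + 0 *\<^sub>R ?v) < w (z1 + (0 - h) *\<^sub>R ?v)"
      using DERIV_neg_dec_left[OF has_real_derivative_partial_deriv_0[OF w, of z1 ?v]] by fastforce
    define h where "h = min b d / 2"
    have h: "0 < h" "h < b" "h < d" using b d by (auto simp: h_def)
    show False using b(2)[OF h(1,2)] near[of ?v "- h"] h by (simp add: norm_Pair del: scaleR_Pair)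
  qed
  ultimately show False using Hw[of z1] e by (simp add: heat_operator_def)
qed

text \<open>On the line from \<open>a\<close> through \<open>z\<close>, \<open>f\<close> is a
  polynomial in \<open>s\<close> that vanishes on an open set around 0. Infinitely many roots make
  all its coefficients zero, and \<open>s = 1\<close> is the point \<open>z\<close>.\<close>

lemma real_polynomial_function_eq_0_if_on_open:
  fixes f :: "'a::real_normed_vector \<Rightarrow> real"
  assumes f: "real_polynomial_function f" and S: "open S" "a \<in> S"
    and zero: "\<And>z. z \<in> S \<Longrightarrow> f z = 0"
  shows "f z = 0"
proof -
  define g where "g s = f (a + s *\<^sub>R (z - a))" for s :: real
  have "real_polynomial_function g"
    unfolding g_def by (rule real_polynomial_function_compose_line[OF f])
  then obtain c n where g: "g = (\<lambda>s. \<Sum>i\<le>n. c i * s ^ i)"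
    using real_polynomial_function_imp_sum by blast
  have "open ((\<lambda>s::real. a + s *\<^sub>R (z - a)) -` S)"
    by (intro open_vimage S continuous_intros)
  moreover have "0 \<in> (\<lambda>s::real. a + s *\<^sub>R (z - a)) -` S" using S by simp
  ultimately have "infinite ((\<lambda>s::real. a + s *\<^sub>R (z - a)) -` S)"
    using finite_imp_not_open by blast
  moreover have "(\<lambda>s::real. a + s *\<^sub>R (z - a)) -` S \<subseteq> {s. (\<Sum>i\<le>n. c i * s ^ i) = 0}"
  proof
    fix s assume "s \<in> (\<lambda>s::real. a + s *\<^sub>R (z - a)) -` S"
    then have "g s = 0" using zero by (simp add: g_def)
    then show "s \<in> {s. (\<Sum>i\<le>n. c i * s ^ i) = 0}" unfolding g by simp
  qed
  ultimately have "infinite {s. (\<Sum>i\<le>n. c i * s ^ i) = 0}"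
    using finite_subset by blast
  then have "\<forall>i\<le>n. c i = 0" using polyfun_finite_roots by blast
  then have "g 1 = 0" by (simp add: g)
  then show ?thesis by (simp add: g_def)
qed

lemma in_paraboloid_region: "(0, 1) \<in> paraboloid_region"
  by (simp add: paraboloid_region_def)

text \<open>The one-sided bound, applied to \<open>u\<close> and to \<open>-u\<close>, gives zero
  only inside the paraboloid; the identity principle for polynomials carries this to the whole
  space.\<close>

lemma caloric_eq_0_if_0_on_paraboloid:
  fixes u :: "(real ^ 'n) \<times> real \<Rightarrow> real"
  assumes u: "real_polynomial_function u"
    and H: "\<And>z. heat_operator u z = 0"
    and bdry: "\<And>z. z \<in> paraboloid_boundary \<Longrightarrow> u z = 0"
  shows "u z = 0"
proof (rule real_polynomial_function_eq_0_if_on_open[OF u open_paraboloid_region in_paraboloid_region])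
  fix z :: "(real ^ 'n) \<times> real" assume z: "z \<in> paraboloid_region"
  have u': "real_polynomial_function (\<lambda>z. (- 1) * u z)"
    by (intro real_polynomial_function_mult real_polynomial_function_const u)
  have "(- 1) * u z \<le> 0"
    by (rule caloric_nonpos_in_paraboloid[OF u' _ _ z]) (simp_all only: heat_operator_cmult[OF u] H bdry mult_zero_right)
  with caloric_nonpos_in_paraboloid[OF u H bdry z] show "u z = 0" by simp
qed

section \<open>The parabolic grading\<close>

text \<open>Polynomials filtered by weighted degree, with weight 1 for each spatial coordinate and
  weight 2 for time. Adjoining one coordinate factor at a time lets derivatives be computed by
  induction with the product rule.\<close>

inductive parabolic_degree_le :: "nat \<Rightarrow> ((real ^ 'n) \<times> real \<Rightarrow> real) \<Rightarrow> bool" where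
  const: "parabolic_degree_le m (\<lambda>_. c)"
| add: "parabolic_degree_le m f \<Longrightarrow> parabolic_degree_le m g \<Longrightarrow> parabolic_degree_le m (\<lambda>z. f z + g z)"
| space: "parabolic_degree_le m f \<Longrightarrow> parabolic_degree_le (Suc m) (\<lambda>z. fst z $ j * f z)"
| time: "parabolic_degree_le m f \<Longrightarrow> parabolic_degree_le (Suc (Suc m)) (\<lambda>z. snd z * f z)"

lemma bounded_linear_fst_nth: "bounded_linear (\<lambda>z :: (real ^ 'n) \<times> real. fst z $ j)"
  by (rule bounded_linear_compose[OF bounded_linear_vec_nth bounded_linear_fst])

lemma parabolic_degree_le_imp_polynomial:
  "parabolic_degree_le m f \<Longrightarrow> real_polynomial_function f"
proof (induction rule: parabolic_degree_le.induct)
  case (space m f j)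
  then show ?case
    using real_polynomial_function_mult[OF real_polynomial_function_linear[OF bounded_linear_fst_nth]] by blast
next
  case (time m f)
  then show ?case
    using real_polynomial_function_mult[OF real_polynomial_function_linear[OF bounded_linear_snd]] by blast
qed (auto intro: real_polynomial_function_const real_polynomial_function_add)

lemma parabolic_degree_le_mono:
  "parabolic_degree_le m f \<Longrightarrow> m \<le> n \<Longrightarrow> parabolic_degree_le n f"
proof (induction arbitrary: n rule: parabolic_degree_le.induct)
  case (space m f j)
  then show ?case by (cases n) (auto intro: parabolic_degree_le.space)
next
  case (time m f)
  then obtain k where "n = Suc (Suc k)" "m \<le> k" by (metis Suc_le_D Suc_le_mono)
  with time show ?case by (auto intro: parabolic_degree_le.time)
qed (auto intro: parabolic_degree_le.intros)

lemma parabolic_degree_le_mult: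
  assumes "parabolic_degree_le m f" "parabolic_degree_le n g"
  shows "parabolic_degree_le (m + n) (\<lambda>z. f z * g z)"
  using assms
proof (induction rule: parabolic_degree_le.induct)
  case (const m c)
  \<comment> \<open>Scaling is not among the generating rules; an inner induction pushes
    \<open>c\<close> through \<open>g\<close> down to its constants.\<close>
  from const have "parabolic_degree_le n (\<lambda>z. c * g z)"
  proof (induction rule: parabolic_degree_le.induct)
    case (const m d)
    then show ?case by (rule parabolic_degree_le.const)
  next
    case (add m f g)
    then show ?case by (simp add: distrib_left parabolic_degree_le.add)
  next
    case (space m f j)
    from parabolic_degree_le.space[OF space.IH, of j] show ?case by (simp add: mult.left_commute)
  next
    case (time m f)
    from parabolic_degree_le.time[OF time.IH] show ?case by (simp add: mult.left_commute)
  qed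
  then show ?case by (rule parabolic_degree_le_mono) simp
next
  case (add m f h)
  then show ?case by (simp add: distrib_right parabolic_degree_le.add)
next
  case (space m f j)
  from parabolic_degree_le.space[OF space.IH[OF space.prems], of j] show ?case by (simp add: mult.assoc)
next
  case (time m f)
  from parabolic_degree_le.time[OF time.IH[OF time.prems]] show ?case by (simp add: mult.assoc)
qed

lemma parabolic_degree_le_cmult:
  "parabolic_degree_le m f \<Longrightarrow> parabolic_degree_le m (\<lambda>z. c * f z)"
  using parabolic_degree_le_mult[OF parabolic_degree_le.const[of 0 c]] by simp

lemma parabolic_degree_le_diff:
  assumes "parabolic_degree_le m f" "parabolic_degree_le m g"
  shows "parabolic_degree_le m (\<lambda>z. f z - g z)"
  using parabolic_degree_le.add[OF assms(1) parabolic_degree_le_cmult[OF assms(2), of "-1"]] by simp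

lemma parabolic_degree_le_sum:
  assumes "\<And>i. i \<in> I \<Longrightarrow> parabolic_degree_le m (f i)"
  shows "parabolic_degree_le m (\<lambda>z. \<Sum>i\<in>I. f i z)"
  using assms
  by (induction I rule: infinite_finite_induct)
    (auto intro: parabolic_degree_le.const parabolic_degree_le.add)

lemma parabolic_degree_le_fst_nth: "parabolic_degree_le 1 (\<lambda>z. fst z $ j)"
  using parabolic_degree_le.space[OF parabolic_degree_le.const[of 0 1]] by simp

lemma parabolic_degree_le_snd: "parabolic_degree_le 2 snd"
  using parabolic_degree_le.time[OF parabolic_degree_le.const[of 0 1]] by (simp add: numeral_2_eq_2)

lemma real_polynomial_function_imp_parabolic_degree_le:
  fixes f :: "(real ^ 'n) \<times> real \<Rightarrow> real"
  assumes "real_polynomial_function f"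
  shows "\<exists>m. parabolic_degree_le m f"
  using assms
proof induction
  case (linear f)
  interpret bounded_linear f by (rule linear)
  \<comment> \<open>A linear form is expanded in the coordinates. Its degree bound is 2 rather than
    1 because \<open>t\<close> may occur.\<close>
  have "f z = (\<Sum>j\<in>UNIV. f (axis j 1, 0) * fst z $ j) + f (0, 1) * snd z" for z
  proof -
    have "(fst z, 0) = (\<Sum>j\<in>UNIV. (fst z $ j) *\<^sub>R (axis j 1, 0 :: real))"
    proof -
      have "(\<Sum>j\<in>UNIV. (fst z $ j) *\<^sub>R axis j 1) = fst z"
        using basis_expansion[of "fst z"] by (simp add: scalar_mult_eq_scaleR)
      then show ?thesis by (simp add: prod_eq_iff fst_sum snd_sum)
    qed
    then have "f (fst z, 0) = (\<Sum>j\<in>UNIV. fst z $ j * f (axis j 1, 0))"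
      by (simp only: sum scaleR real_scaleR_def)
    moreover have "f (0, snd z) = snd z * f (0, 1)"
      using scaleR[of "snd z" "(0, 1)"] by simp
    moreover have "z = (fst z, 0) + (0, snd z)" by (simp add: prod_eq_iff)
    ultimately show ?thesis by (metis (no_types, lifting) add mult.commute sum.cong)
  qed
  then have "f = (\<lambda>z. (\<Sum>j\<in>UNIV. f (axis j 1, 0) * fst z $ j) + f (0, 1) * snd z)" by blast
  moreover have "parabolic_degree_le 2 (\<lambda>z. (\<Sum>j\<in>UNIV. f (axis j 1, 0) * fst z $ j) + f (0, 1) * snd z)"
    by (intro parabolic_degree_le.add parabolic_degree_le_sum parabolic_degree_le_cmult
        parabolic_degree_le_snd parabolic_degree_le_mono[OF parabolic_degree_le_fst_nth]) simp
  ultimately show ?case by metis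
next
  case (const c)
  then show ?case by (blast intro: parabolic_degree_le.const)
next
  case (add f g)
  then obtain m n where mn: "parabolic_degree_le m f" "parabolic_degree_le n g" by blast
  have "parabolic_degree_le (max m n) (\<lambda>z. f z + g z)"
    using mn[THEN parabolic_degree_le_mono, of "max m n"] by (simp add: parabolic_degree_le.add)
  then show ?case by blast
next
  case (mult f g)
  then show ?case by (blast intro: parabolic_degree_le_mult)
qed

text \<open>Degree 0 is treated apart, with a derivative that vanishes outright: in the
  \<open>space\<close> case the term \<open>x_j * d f\<close> must stay within degree
  \<open>m\<close>, and for \<open>m = 0\<close> it is not enough that \<open>d f\<close> is
  constant.\<close>

lemma partial_deriv_space_degree:
  assumes "parabolic_degree_le m f"
  shows "(m = 0 \<longrightarrow> partial_deriv (v, 0) f = (\<lambda>_. 0)) \<and>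
    (\<forall>k. m = Suc k \<longrightarrow> parabolic_degree_le k (partial_deriv (v, 0) f))"
  using assms
proof (induction rule: parabolic_degree_le.induct)
  case (const m c)
  then show ?case by (simp add: parabolic_degree_le.const)
next
  case (add m f g)
  then show ?case
    by (auto simp: partial_deriv_add parabolic_degree_le_imp_polynomial intro: parabolic_degree_le.add)
next
  case (space m f j)
  let ?d = "partial_deriv (v, 0) f"
  have eq: "partial_deriv (v, 0) (\<lambda>z. fst z $ j * f z) = (\<lambda>z. v $ j * f z + fst z $ j * ?d z)"
    using space bounded_linear_fst_nth[of j]
    by (subst partial_deriv_mult)
      (auto simp: partial_deriv_bounded_linear parabolic_degree_le_imp_polynomial mult.commute)
  have "parabolic_degree_le m (\<lambda>z. fst z $ j * ?d z)"
    using space.IH by (cases m) (auto intro: parabolic_degree_le.intros)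
  with space show ?case
    by (auto simp: eq intro!: parabolic_degree_le.add parabolic_degree_le_cmult)
next
  case (time m f)
  let ?d = "partial_deriv (v, 0) f"
  have eq: "partial_deriv (v, 0) (\<lambda>z. snd z * f z) = (\<lambda>z. snd z * ?d z)"
    using time bounded_linear_snd
    by (subst partial_deriv_mult)
      (auto simp: partial_deriv_bounded_linear parabolic_degree_le_imp_polynomial mult.commute)
  have "parabolic_degree_le (Suc m) (\<lambda>z. snd z * ?d z)"
    using time.IH by (cases m) (auto intro: parabolic_degree_le.intros)
  then show ?case by (simp add: eq)
qed

text \<open>A time derivative costs two degrees, so here degrees 0 and 1 are both exceptional and
  the derivative vanishes in each.\<close>

lemma partial_deriv_time_degree:
  assumes "parabolic_degree_le m f"
  shows "(m < 2 \<longrightarrow> partial_deriv (0, r) f = (\<lambda>_. 0)) \<and>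
    (\<forall>k. m = Suc (Suc k) \<longrightarrow> parabolic_degree_le k (partial_deriv (0, r) f))"
  using assms
proof (induction rule: parabolic_degree_le.induct)
  case (const m c)
  then show ?case by (simp add: parabolic_degree_le.const)
next
  case (add m f g)
  then show ?case
    by (auto simp: partial_deriv_add parabolic_degree_le_imp_polynomial intro: parabolic_degree_le.add)
next
  case (space m f j)
  let ?d = "partial_deriv (0, r) f"
  have eq: "partial_deriv (0, r) (\<lambda>z. fst z $ j * f z) = (\<lambda>z. fst z $ j * ?d z)"
    using space bounded_linear_fst_nth[of j]
    by (subst partial_deriv_mult)
      (auto simp: partial_deriv_bounded_linear parabolic_degree_le_imp_polynomial mult.commute)
  \<comment> \<open>For \<open>k = 0\<close> this is \<open>m = 1\<close>, where the derivative of
    \<open>f\<close> is zero; otherwise the factor \<open>x_j\<close> restores one of the two lost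
    degrees.\<close>
  have "parabolic_degree_le k (\<lambda>z. fst z $ j * ?d z)" if "m = Suc k" for k
    using space.IH that by (cases k) (auto intro: parabolic_degree_le.intros)
  with space.IH show ?case by (auto simp: eq)
next
  case (time m f)
  let ?d = "partial_deriv (0, r) f"
  have eq: "partial_deriv (0, r) (\<lambda>z. snd z * f z) = (\<lambda>z. r * f z + snd z * ?d z)"
    using time bounded_linear_snd
    by (subst partial_deriv_mult)
      (auto simp: partial_deriv_bounded_linear parabolic_degree_le_imp_polynomial mult.commute)
  have "parabolic_degree_le m (\<lambda>z. snd z * ?d z)"
  proof (cases "m < 2")
    case True
    with time.IH show ?thesis by (simp add: parabolic_degree_le.const)
  next
    case False
    then obtain k where "m = Suc (Suc k)" by (metis One_nat_def less_2_cases_iff not0_implies_Suc)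
    with time.IH show ?thesis by (auto intro: parabolic_degree_le.time)
  qed
  with time show ?case
    by (auto simp: eq intro!: parabolic_degree_le.add parabolic_degree_le_cmult)
qed

lemma heat_operator_degree:
  assumes "parabolic_degree_le (Suc (Suc m)) f"
  shows "parabolic_degree_le m (heat_operator f)"
proof -
  have "parabolic_degree_le m (partial_deriv (v, 0) (partial_deriv (v, 0) f))" for v
    using partial_deriv_space_degree assms by blast
  moreover have "parabolic_degree_le m (partial_deriv (0, 1) f)"
    using partial_deriv_time_degree assms by blast
  ultimately show ?thesis
    unfolding heat_operator_def[abs_def] spatial_laplacian_def
    by (intro parabolic_degree_le_diff parabolic_degree_le_sum)
qed

section \<open>Finite dimension of the graded spaces\<close>

interpretation pointwise: vector_space "\<lambda>(c::real) (f::'a \<Rightarrow> real) z. c * f z"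
  by unfold_locales (auto simp: fun_eq_iff algebra_simps)

lemma parabolic_degree_le_finite_span:
  "\<exists>B. finite B \<and>
    {f :: (real ^ 'n) \<times> real \<Rightarrow> real. parabolic_degree_le m f} \<subseteq> pointwise.span B"
proof -
  \<comment> \<open>\<open>M m\<close> consists of the monomials with at most \<open>m\<close>
    coordinate factors. Some have parabolic degree above \<open>m\<close>, which is harmless: any
    finite set whose span contains the space will do.\<close>
  define M :: "nat \<Rightarrow> ((real ^ 'n) \<times> real \<Rightarrow> real) set" where
    "M = rec_nat {\<lambda>_. 1} (\<lambda>_ A. A \<union> (\<Union>j. (\<lambda>b z. fst z $ j * b z) ` A) \<union> (\<lambda>b z. snd z * b z) ` A)"
  have M0: "M 0 = {\<lambda>_. 1}" by (simp add: M_def)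
  have MSuc: "M (Suc m) = M m \<union> (\<Union>j. (\<lambda>b z. fst z $ j * b z) ` M m) \<union> (\<lambda>b z. snd z * b z) ` M m" for m
    by (simp add: M_def)
  have fin: "finite (M m)" for m
    by (induction m) (auto simp: M0 MSuc)
  have one: "(\<lambda>_. 1) \<in> M m" for m
    by (induction m) (auto simp: M0 MSuc)
  \<comment> \<open>Multiplication by a fixed \<open>h\<close> is linear, so it suffices to check it
    on the generators.\<close>
  have mult_span: "(\<lambda>z. h z * f z) \<in> pointwise.span B"
    if "f \<in> pointwise.span A" and AB: "\<And>b. b \<in> A \<Longrightarrow> (\<lambda>z. h z * b z) \<in> B"
    for f h :: "(real ^ 'n) \<times> real \<Rightarrow> real" and A B
    using that(1)
  proof (induction rule: pointwise.span_induct_alt)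
    case base
    show ?case using pointwise.span_zero[of B] by (simp add: zero_fun_def)
  next
    case (step c x y)
    have "(\<lambda>z. c * (h z * x z)) + (\<lambda>z. h z * y z) \<in> pointwise.span B"
      using step AB by (intro pointwise.span_add pointwise.span_scale) (auto intro: pointwise.span_base)
    then show ?case by (simp add: plus_fun_def algebra_simps)
  qed
  have "f \<in> pointwise.span (M m)" if "parabolic_degree_le m f" for f
    using that
  proof (induction rule: parabolic_degree_le.induct)
    case (const m c)
    show ?case using pointwise.span_scale[OF pointwise.span_base[OF one[of m]], of c] by simp
  next
    case (add m f g)
    then show ?case using pointwise.span_add[of f "M m" g] by (simp add: plus_fun_def)
  next
    case (space m f j)
    show ?case by (rule mult_span[OF space.IH]) (auto simp: MSuc)
  next
    case (time m f)
    \<comment> \<open>A factor \<open>t\<close> adds one factor but two degrees, so one further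
      inclusion between the sets \<open>M\<close> is needed.\<close>
    have "(\<lambda>z. snd z * f z) \<in> pointwise.span (M (Suc m))"
      by (rule mult_span[OF time.IH]) (auto simp: MSuc)
    moreover have "M (Suc m) \<subseteq> M (Suc (Suc m))" by (auto simp: MSuc)
    ultimately show ?case using pointwise.span_mono by blast
  qed
  with fin show ?thesis by blast
qed

section \<open>Solving the Dirichlet problem on the paraboloid\<close>

definition paraboloid_poly :: "(real ^ 'n) \<times> real \<Rightarrow> real" where
  "paraboloid_poly z = snd z - (\<Sum>j\<in>UNIV. fst z $ j * fst z $ j)"

text \<open>The coordinate form serves the degree count; the norm form shows the zeros on the
  paraboloid and the positive sign inside.\<close>

lemma paraboloid_poly_eq: "paraboloid_poly z = snd z - (norm (fst z))\<^sup>2"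
  by (simp add: paraboloid_poly_def dot_square_norm[symmetric] inner_vec_def)

lemma parabolic_degree_le_paraboloid_poly: "parabolic_degree_le 2 paraboloid_poly"
  unfolding paraboloid_poly_def[abs_def]
  using parabolic_degree_le_mult[OF parabolic_degree_le_fst_nth parabolic_degree_le_fst_nth]
  by (intro parabolic_degree_le_diff parabolic_degree_le_sum parabolic_degree_le_snd)
    (simp add: numeral_2_eq_2)

lemma heat_operator_paraboloid_poly_surj:
  fixes g :: "(real ^ 'n) \<times> real \<Rightarrow> real"
  assumes "parabolic_degree_le m g"
  shows "\<exists>q. real_polynomial_function q \<and> heat_operator (\<lambda>z. paraboloid_poly z * q z) = g"
proof -
  let ?V = "{f :: (real ^ 'n) \<times> real \<Rightarrow> real. parabolic_degree_le m f}"
  let ?T = "\<lambda>q. heat_operator (\<lambda>z. paraboloid_poly z * q z)"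
  obtain B :: "((real ^ 'n) \<times> real \<Rightarrow> real) set" where B: "finite B" "?V \<subseteq> pointwise.span B"
    using parabolic_degree_le_finite_span by blast
  have degree: "parabolic_degree_le (Suc (Suc m)) (\<lambda>z. paraboloid_poly z * q z)" if "q \<in> ?V" for q
    using parabolic_degree_le_mult[OF parabolic_degree_le_paraboloid_poly, of m q] that by simp
  note poly = parabolic_degree_le_imp_polynomial[OF degree]
  have "\<exists>q\<in>?V. ?T q = g"
  proof (rule pointwise.injective_imp_surjective_on_finite_span[OF _ B])
    show "pointwise.subspace ?V"
      unfolding pointwise.subspace_def zero_fun_def plus_fun_def
      by (auto intro: parabolic_degree_le.const parabolic_degree_le.add parabolic_degree_le_cmult)
    show "?T q \<in> ?V" if "q \<in> ?V" for q
      using heat_operator_degree[OF degree[OF that]] by simp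
    show "?T (q + r) = ?T q + ?T r" if "q \<in> ?V" "r \<in> ?V" for q r
      using heat_operator_add[OF poly[OF that(1)] poly[OF that(2)]]
      by (simp add: fun_eq_iff distrib_left)
    show "?T (\<lambda>z. c * q z) = (\<lambda>z. c * ?T q z)" if "q \<in> ?V" for c q
      using heat_operator_cmult[OF poly[OF that], of c] by (simp add: fun_eq_iff mult.left_commute)
    show "q = 0" if q: "q \<in> ?V" "?T q = 0" for q
    proof
      fix z
      have "paraboloid_poly z * q z = 0" for z
      proof (rule caloric_eq_0_if_0_on_paraboloid[OF poly[OF q(1)]])
        show "?T q z = 0" for z using q(2) by simp
        show "paraboloid_poly z * q z = 0" if "z \<in> paraboloid_boundary" for z
          using that by (auto simp: paraboloid_boundary_def paraboloid_poly_eq)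
      qed
      \<comment> \<open>The product is zero everywhere and its first factor is positive inside the
        paraboloid, so \<open>q\<close> vanishes on that open set and hence identically.\<close>
      then have "q z = 0" if "z \<in> paraboloid_region" for z
        using that by (force simp: paraboloid_region_def paraboloid_poly_eq)
      moreover have "real_polynomial_function q"
        using q(1) by (simp add: parabolic_degree_le_imp_polynomial)
      ultimately show "q z = 0 z"
        using real_polynomial_function_eq_0_if_on_open[OF _ open_paraboloid_region in_paraboloid_region, of q]
        by simp
    qed
    show "g \<in> ?V" using assms by simp
  qed
  then show ?thesis using parabolic_degree_le_imp_polynomial by blast
qed

theorem corollary1p2:
  fixes p :: "(real ^ 'n) \<times> real \<Rightarrow> real"
  assumes "real_polynomial_function p"
  shows "\<exists>!u :: (real ^ 'n) \<times> real \<Rightarrow> real.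
           real_polynomial_function u \<and>
           (\<forall>z. heat_operator u z = 0) \<and>
           (\<forall>z\<in>paraboloid_boundary. u z = p z)"
proof -
  obtain m where "parabolic_degree_le m p"
    using real_polynomial_function_imp_parabolic_degree_le[OF assms] by blast
  \<comment> \<open>The bound on \<open>p\<close> is first weakened to \<open>Suc (Suc m)\<close>.
    The sharper degree of \<open>H p\<close> is irrelevant; any finite-dimensional space containing
    it works.\<close>
  then have "parabolic_degree_le m (heat_operator p)"
    by (intro heat_operator_degree) (rule parabolic_degree_le_mono, auto)
  then obtain q where q: "real_polynomial_function q"
    "heat_operator (\<lambda>z. paraboloid_poly z * q z) = heat_operator p"
    using heat_operator_paraboloid_poly_surj by blast
  have poly: "real_polynomial_function (\<lambda>z. paraboloid_poly z * q z)"
    using parabolic_degree_le_imp_polynomial[OF parabolic_degree_le_paraboloid_poly] q(1)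
    by (rule real_polynomial_function_mult)
  show ?thesis
  proof (rule ex1I)
    \<comment> \<open>The subtracted product vanishes on the paraboloid and has the same image under
      \<open>H\<close> as \<open>p\<close>, so it removes \<open>H p\<close> without changing the
      boundary values.\<close>
    let ?u = "\<lambda>z. p z - paraboloid_poly z * q z"
    show "real_polynomial_function ?u \<and> (\<forall>z. heat_operator ?u z = 0) \<and>
        (\<forall>z\<in>paraboloid_boundary. ?u z = p z)"
      using real_polynomial_function_diff[OF assms poly] heat_operator_diff[OF assms poly] q(2)
      by (auto simp: paraboloid_boundary_def paraboloid_poly_eq)
    fix w
    assume w: "real_polynomial_function w \<and> (\<forall>z. heat_operator w z = 0) \<and>
        (\<forall>z\<in>paraboloid_boundary. w z = p z)"
    have u: "real_polynomial_function ?u" by (rule real_polynomial_function_diff[OF assms poly])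
    have "w z - ?u z = 0" for z
    proof (rule caloric_eq_0_if_0_on_paraboloid)
      show "real_polynomial_function (\<lambda>z. w z - ?u z)"
        using w by (intro real_polynomial_function_diff[OF _ u]) blast
      show "heat_operator (\<lambda>z. w z - ?u z) z = 0" for z
        using w heat_operator_diff[OF _ u, of w z] heat_operator_diff[OF assms poly, of z] q(2)
        by (simp del: split_paired_All)
      show "w z - ?u z = 0" if "z \<in> paraboloid_boundary" for z
        using w that by (auto simp: paraboloid_boundary_def paraboloid_poly_eq)
    qed
    then show "w = ?u" by (auto simp: fun_eq_iff)
  qed
qed

end
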